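(* Let $\mathbb{K}$ be a perfect field with $\mathrm{char}(\mathbb{K})\neq 2$. Let $(V,\sigma)$ be a finite dimensional symplectic $\mathbb{K}$-vector space with $\dim(V)=2n$, $n\in\mathbb{Z}_{>0}$. Let $f:V\to V$ be a self-adjoint operator on $V$. Then there exist a Darboux basis $\{u_1,\ldots,u_n,w_1,\ldots,w_n\}$ of $V$ and a $\mathbb{K}$-linear transformation $l:U\to U$, where $U=\mathrm{Span}(u_1,\ldots,u_n)$, such that $$\Phi\circ(l,l^* )=f\circ\Phi,$$ where $\Phi:U\times U^*\to V$ is the $\mathbb{K}$-linear isomorphism determined by $\Phi(u_i,0)=u_i$ and $\Phi(0,\lambda_i)=w_i$ for $i=1,\ldots,n$, with $\{\lambda_1,\ldots,\lambda_n\}$ the basis of the dual space $U^*$ dual to $\{u_1,\ldots,u_n\}$ (i.e. $\lambda_i(u_j)=\delta_{ij}$).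
   Context: A symplectic form on a $\mathbb{K}$-vector space $V$ is an alternating non-degenerate bilinear form $\sigma:V\times V\to\mathbb{K}$; the pair $(V,\sigma)$ is called a symplectic vector space. A Darboux basis of $V$ is a basis $\{u_1,\ldots,u_n,w_1,\ldots,w_n\}$ with $\sigma(u_i,u_j)=0$, $\sigma(w_i,w_j)=0$ and $\sigma(w_i,u_j)=\delta_{ij}$ for all $i,j\in\{1,\ldots,n\}$. A $\mathbb{K}$-linear map $f:V\to V$ is self-adjoint if $\sigma(v,f(w))=\sigma(f(v),w)$ for all $v,w\in V$. For a linear map $l:U\to U$, $l^*:U^*\to U^*$ denotes the dual map $l^*(\lambda)=\lambda\circ l$, and $(l,l^* ):U\times U^*\to U\times U^*$ is the map $(v,\lambda)\mapsto(l(v),l^*(\lambda))$. *)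

theory Defs
  imports
    "HOL-Algebra.Algebraic_Closure_Type"
    "HOL-Analysis.Product_Vector"
    "HOL-Library.Function_Algebras"
begin

text \<open>
  Perfect fields: every irreducible polynomial is separable, i.e. has only simple roots in an
  algebraic closure.
\<close>
definition perfect_field :: "'k::field itself \<Rightarrow> bool" where
  "perfect_field _ \<longleftrightarrow>
     (\<forall>p :: 'k poly. Factorial_Ring.irreducible p \<longrightarrow> rsquarefree (map_poly to_ac p))"

definition symplectic_form ::
    "('k::field \<Rightarrow> 'v::ab_group_add \<Rightarrow> 'v) \<Rightarrow> ('v \<Rightarrow> 'v \<Rightarrow> 'k) \<Rightarrow> bool" where
  "symplectic_form smul \<sigma> \<longleftrightarrow>
     (\<forall>v. Vector_Spaces.linear smul (*) (\<lambda>w. \<sigma> v w)) \<and>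
     (\<forall>w. Vector_Spaces.linear smul (*) (\<lambda>v. \<sigma> v w)) \<and>
     (\<forall>v. \<sigma> v v = 0) \<and>
     (\<forall>v. (\<forall>w. \<sigma> v w = 0) \<longrightarrow> v = 0)"

definition self_adjoint :: "('v \<Rightarrow> 'v \<Rightarrow> 'k) \<Rightarrow> ('v \<Rightarrow> 'v) \<Rightarrow> bool" where
  "self_adjoint \<sigma> f \<longleftrightarrow> (\<forall>v w. \<sigma> v (f w) = \<sigma> (f v) w)"

text \<open>
  The injectivity and disjointness conditions make \<^term>\<open>u\<close> and \<^term>\<open>w\<close> together a basis as an
  indexed family of \<^term>\<open>2 * n\<close> vectors, and not merely as a set.
\<close>
definition darboux_basis ::
    "('k::field \<Rightarrow> 'v::ab_group_add \<Rightarrow> 'v) \<Rightarrow> ('v \<Rightarrow> 'v \<Rightarrow> 'k) \<Rightarrow> nat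
     \<Rightarrow> (nat \<Rightarrow> 'v) \<Rightarrow> (nat \<Rightarrow> 'v) \<Rightarrow> bool" where
  "darboux_basis smul \<sigma> n u w \<longleftrightarrow>
     inj_on u {1..n} \<and> inj_on w {1..n} \<and> u ` {1..n} \<inter> w ` {1..n} = {} \<and>
     \<not> module.dependent smul (u ` {1..n} \<union> w ` {1..n}) \<and>
     module.span smul (u ` {1..n} \<union> w ` {1..n}) = UNIV \<and>
     (\<forall>i\<in>{1..n}. \<forall>j\<in>{1..n}.
        \<sigma> (u i) (u j) = 0 \<and> \<sigma> (w i) (w j) = 0 \<and> \<sigma> (w i) (u j) = (if i = j then 1 else 0))"

text \<open>
  Linear maps between the subspaces \<^term>\<open>S\<close> and \<^term>\<open>T\<close>; the values of \<^term>\<open>f\<close> outside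
  \<^term>\<open>S\<close> are irrelevant.
\<close>
definition linear_on ::
    "('k::field \<Rightarrow> 'a::ab_group_add \<Rightarrow> 'a) \<Rightarrow> ('k \<Rightarrow> 'b::ab_group_add \<Rightarrow> 'b)
     \<Rightarrow> 'a set \<Rightarrow> 'b set \<Rightarrow> ('a \<Rightarrow> 'b) \<Rightarrow> bool" where
  "linear_on s1 s2 S T f \<longleftrightarrow>
     f ` S \<subseteq> T \<and>
     (\<forall>x\<in>S. \<forall>y\<in>S. f (x + y) = f x + f y) \<and>
     (\<forall>c. \<forall>x\<in>S. f (s1 c x) = s2 c (f x))"

text \<open>
  A functional on a subspace \<^term>\<open>U\<close> is represented by its extension by zero, so that equality of
  functionals is equality of functions and the dual space is a subspace of the space of all
  functions with pointwise operations.
\<close>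
definition dual_space ::
    "('k::field \<Rightarrow> 'v::ab_group_add \<Rightarrow> 'v) \<Rightarrow> 'v set \<Rightarrow> ('v \<Rightarrow> 'k) set" where
  "dual_space smul U =
     {\<phi>. linear_on smul (*) U UNIV \<phi> \<and> (\<forall>x. x \<notin> U \<longrightarrow> \<phi> x = 0)}"

definition fun_scale :: "'k::field \<Rightarrow> ('v \<Rightarrow> 'k) \<Rightarrow> 'v \<Rightarrow> 'k" where
  "fun_scale c \<phi> = (\<lambda>x. c * \<phi> x)"

definition dual_map :: "'v set \<Rightarrow> ('v \<Rightarrow> 'v) \<Rightarrow> ('v \<Rightarrow> 'k::field) \<Rightarrow> 'v \<Rightarrow> 'k" where
  "dual_map U l \<phi> = (\<lambda>x. if x \<in> U then \<phi> (l x) else 0)"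

definition dual_basis ::
    "('k::field \<Rightarrow> 'v::ab_group_add \<Rightarrow> 'v) \<Rightarrow> 'v set \<Rightarrow> nat
     \<Rightarrow> (nat \<Rightarrow> 'v) \<Rightarrow> (nat \<Rightarrow> 'v \<Rightarrow> 'k) \<Rightarrow> bool" where
  "dual_basis smul U n u lam \<longleftrightarrow>
     (\<forall>i\<in>{1..n}. lam i \<in> dual_space smul U \<and>
        (\<forall>j\<in>{1..n}. lam i (u j) = (if i = j then 1 else 0)))"

lemma vector_space_fun_scale: "vector_space fun_scale"
  by unfold_locales (auto simp: fun_scale_def algebra_simps)

lemma prod_scale_fun_scale:
  assumes "vector_space smul"
  shows "module_prod.scale smul fun_scale c (x, \<phi>) = (smul c x, fun_scale c \<phi>)"
proof -
  interpret module_prod smul fun_scale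
    using assms vector_space_fun_scale
    by (simp add: module_prod_def module_pair_def module_iff_vector_space)
  show ?thesis by (rule scale_prod)
qed

lemma subspace_dual_space:
  assumes "vector_space smul"
  shows "module.subspace fun_scale (dual_space smul U)"
proof -
  interpret vector_space fun_scale by (rule vector_space_fun_scale)
  show ?thesis
    by (auto simp: subspace_def dual_space_def linear_on_def fun_scale_def algebra_simps)
qed

lemma dual_map_in_dual_space:
  assumes "vector_space smul" "module.subspace smul U"
    and "linear_on smul smul U U l" "\<phi> \<in> dual_space smul U"
  shows "dual_map U l \<phi> \<in> dual_space smul U"
proof -
  interpret vector_space smul by fact
  show ?thesis
    using assms(2-)
    by (auto simp: dual_map_def dual_space_def linear_on_def image_subset_iff
      subspace_add subspace_scale)
qed

end

theory Submission
  imports Defs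
begin

text \<open>
  Every power of a self-adjoint \<open>f\<close> is self-adjoint and the characteristic is not 2, so
  \<open>\<sigma> (f\<^sup>i x) (f\<^sup>j x) = 0\<close>: cyclic subspaces are isotropic. Let \<open>v\<close> generate a cyclic subspace of
  maximal dimension \<open>d\<close>, with \<open>f\<^sup>d v = \<Sum>k<d. c\<^sub>k f\<^sup>k v\<close>, and let \<open>w\<close> satisfy \<open>\<sigma> w (f\<^sup>i v) = 0\<close> for
  \<open>i < d - 1\<close> and \<open>\<sigma> w (f\<^bsup>d-1\<^esup> v) = 1\<close>. The Horner vectors \<open>e\<^sub>0 = w\<close>,
  \<open>e\<^bsub>k+1\<^esub> = f e\<^sub>k - c\<^bsub>d-1-k\<^esub> w\<close> are then dual to the \<open>f\<^sup>i v\<close>, and they span the cyclic subspace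
  of \<open>w\<close>. This produces an invariant pair of isotropic subspaces in perfect duality; its
  orthogonal complement is again symplectic and invariant, and the construction is repeated there.
\<close>

section \<open>Symplectic linear algebra with a self-adjoint operator\<close>

locale self_adjoint_symplectic = finite_dimensional_vector_space scale Basis
  for scale :: "'k::field \<Rightarrow> 'v::ab_group_add \<Rightarrow> 'v" (infixr \<open>*s\<close> 75) and Basis +
  fixes \<sigma> :: "'v \<Rightarrow> 'v \<Rightarrow> 'k" and f :: "'v \<Rightarrow> 'v"
  assumes char: "CHAR('k) \<noteq> 2"
    and symplectic: "symplectic_form scale \<sigma>"
    and linear_f: "Vector_Spaces.linear scale scale f"
    and adjoint: "self_adjoint \<sigma> f"
begin

lemma two_neq_zero: "(2::'k) \<noteq> 0"
proof
  assume "(2::'k) = 0"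
  then have "of_nat 2 = (0::'k)" by simp
  then have "CHAR('k) dvd 2" by (simp only: of_nat_eq_0_iff_char_dvd)
  then have "CHAR('k) = 1 \<or> CHAR('k) = 2"
    by (metis prime_nat_iff two_is_prime_nat)
  with char show False by simp
qed

lemma sigma_linear_left: "Vector_Spaces.linear scale (*) (\<lambda>x. \<sigma> x y)"
  and sigma_linear_right: "Vector_Spaces.linear scale (*) (\<sigma> x)"
  and sigma_self [simp]: "\<sigma> x x = 0"
  and sigma_nondegenerate: "(\<And>z. \<sigma> x z = 0) \<Longrightarrow> x = 0"
  using symplectic by (auto simp: symplectic_form_def)

text \<open>The order matters: entries 1 to 5 concern the left argument (sum of two, difference,
  scalar, zero, finite sum), entries 6 to 10 the right one. Later proofs select single laws by
  position.\<close>

lemmas sigma_linear_simps =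
  module_hom.add[OF sigma_linear_left[unfolded linear_iff_module_hom]]
  module_hom.diff[OF sigma_linear_left[unfolded linear_iff_module_hom]]
  module_hom.scale[OF sigma_linear_left[unfolded linear_iff_module_hom]]
  module_hom.zero[OF sigma_linear_left[unfolded linear_iff_module_hom]]
  module_hom.sum[OF sigma_linear_left[unfolded linear_iff_module_hom]]
  module_hom.add[OF sigma_linear_right[unfolded linear_iff_module_hom]]
  module_hom.diff[OF sigma_linear_right[unfolded linear_iff_module_hom]]
  module_hom.scale[OF sigma_linear_right[unfolded linear_iff_module_hom]]
  module_hom.zero[OF sigma_linear_right[unfolded linear_iff_module_hom]]
  module_hom.sum[OF sigma_linear_right[unfolded linear_iff_module_hom]]

lemmas f_linear_simps =
  module_hom.add[OF linear_f[unfolded linear_iff_module_hom]]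
  module_hom.diff[OF linear_f[unfolded linear_iff_module_hom]]
  module_hom.scale[OF linear_f[unfolded linear_iff_module_hom]]
  module_hom.zero[OF linear_f[unfolded linear_iff_module_hom]]
  module_hom.sum[OF linear_f[unfolded linear_iff_module_hom]]

lemma sigma_swap: "\<sigma> x y = - \<sigma> y x"
proof -
  have "0 = \<sigma> (x + y) (x + y)" by simp
  also have "\<dots> = \<sigma> x y + \<sigma> y x"
    unfolding sigma_linear_simps by simp
  finally have "\<sigma> x y + \<sigma> y x = 0" by simp
  then show ?thesis by (simp add: eq_neg_iff_add_eq_0)
qed

lemma sigma_f: "\<sigma> (f x) y = \<sigma> x (f y)"
  using adjoint by (simp add: self_adjoint_def)

lemma sigma_funpow: "\<sigma> ((f ^^ i) x) y = \<sigma> x ((f ^^ i) y)"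
  by (induction i arbitrary: y) (auto simp: sigma_f simp flip: funpow_swap1)

text \<open>Collecting all powers on the right gives \<open>\<sigma> x (f^(i+j) x)\<close>. Moving
  them to the left and swapping shows that this equals its own negative, and 2 is
  invertible.\<close>

lemma sigma_orbit: "\<sigma> ((f ^^ i) x) ((f ^^ j) x) = 0"
proof -
  have "\<sigma> ((f ^^ i) x) ((f ^^ j) x) = \<sigma> x ((f ^^ (i + j)) x)"
    by (simp add: sigma_funpow funpow_add)
  moreover have "\<sigma> x ((f ^^ (i + j)) x) = - \<sigma> x ((f ^^ (i + j)) x)"
    by (metis sigma_swap sigma_funpow)
  then have "2 * \<sigma> x ((f ^^ (i + j)) x) = 0"
    by (simp add: eq_neg_iff_add_eq_0 flip: mult_2)
  ultimately show ?thesis using two_neq_zero by simp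
qed

lemma sigma_span_eq_0:
  assumes "\<And>a b. a \<in> A \<Longrightarrow> b \<in> C \<Longrightarrow> \<sigma> a b = 0" and x: "x \<in> span A" and y: "y \<in> span C"
  shows "\<sigma> x y = 0"
proof -
  have a: "\<sigma> a y = 0" if "a \<in> A" for a
    using y by (rule span_induct) (auto simp: subspace_def sigma_linear_simps assms that)
  show ?thesis
    using x by (rule span_induct) (auto simp: subspace_def sigma_linear_simps a)
qed

lemma f_span:
  assumes "\<And>a. a \<in> A \<Longrightarrow> f a \<in> span C" and "x \<in> span A"
  shows "f x \<in> span C"
  using assms(2)
  by (rule span_induct)
    (auto simp: subspace_def f_linear_simps assms(1) span_zero span_add span_scale)

text \<open>Extend \<open>I\<close> to a basis \<open>C\<close> and let \<open>F x\<close> have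
  coordinates \<open>\<sigma> x b\<close>. This replaces the map from the space to its dual by an
  endomorphism: non-degeneracy makes it injective, hence surjective by finite dimension.\<close>

lemma exists_dual_vector:
  assumes "independent I"
  shows "\<exists>w. \<forall>b\<in>I. \<sigma> w b = g b"
proof -
  define C where "C = extend_basis I"
  have C: "I \<subseteq> C" "independent C" "span C = UNIV"
    using extend_basis_superset independent_extend_basis span_extend_basis assms
    by (auto simp: C_def)
  have fin: "finite C" using C(2) by (rule finiteI_independent)
  define F where "F x = (\<Sum>b\<in>C. \<sigma> x b *s b)" for x
  have lin: "Vector_Spaces.linear scale scale F"
    by unfold_locales
      (auto simp: F_def sigma_linear_simps scale_left_distrib sum.distrib scale_sum_right)
  have coeff: "h b = h' b" if "(\<Sum>b\<in>C. h b *s b) = (\<Sum>b\<in>C. h' b *s b)" "b \<in> C" for h h' b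
  proof -
    have "(\<Sum>b\<in>C. (h b - h' b) *s b) = 0"
      using that by (simp add: scale_left_diff_distrib sum_subtractf)
    then have "h b - h' b = 0"
      using C(2) fin that(2) independentD[of C C "\<lambda>b. h b - h' b" b] by auto
    then show ?thesis by simp
  qed
  have "inj F"
  proof (rule injI)
    fix x y assume "F x = F y"
    then have "\<sigma> (x - y) b = 0" if "b \<in> C" for b
      using coeff[of "\<sigma> x" "\<sigma> y" b] that by (auto simp: F_def sigma_linear_simps)
    then have "\<sigma> (x - y) z = 0" for z
      using sigma_span_eq_0[of "{x - y}" C "x - y" z] C(3) span_base[of "x - y" "{x - y}"]
      by auto
    then show "x = y" using sigma_nondegenerate[of "x - y"] by simp
  qed
  then have "surj F" using lin by (rule linear_inj_imp_surj[rotated])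
  then obtain w where "F w = (\<Sum>b\<in>C. g b *s b)" by (metis surjD)
  then have "\<forall>b\<in>C. \<sigma> w b = g b" using coeff[of "\<sigma> w" g] by (auto simp: F_def)
  then show ?thesis using C(1) by blast
qed


subsection \<open>Cyclic subspaces\<close>

text \<open>The Krylov subspaces of \<open>f\<close> at \<open>x\<close>; \<open>cyc x 0\<close> is
  the zero space.\<close>

definition cyc :: "'v \<Rightarrow> nat \<Rightarrow> 'v set" where
  "cyc x k = span ((\<lambda>i. (f ^^ i) x) ` {..<k})"

text \<open>The degree of the minimal polynomial of \<open>f\<close> at \<open>x\<close>. The
  minimum exists by \<open>exists_cyc_stable\<close>.\<close>

definition cyc_deg :: "'v \<Rightarrow> nat" where
  "cyc_deg x = (LEAST k. (f ^^ k) x \<in> cyc x k)"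

lemma funpow_in_cyc: "i < k \<Longrightarrow> (f ^^ i) x \<in> cyc x k"
  by (auto simp: cyc_def intro: span_base)

lemma cyc_mono: "i \<le> k \<Longrightarrow> cyc x i \<subseteq> cyc x k"
  by (auto simp: cyc_def intro!: span_mono)

lemma subspace_cyc: "subspace (cyc x k)"
  by (simp add: cyc_def)

lemma f_cyc_Suc: "y \<in> cyc x k \<Longrightarrow> f y \<in> cyc x (Suc k)"
  unfolding cyc_def
  by (erule f_span[rotated]) (auto intro!: span_base image_eqI[where x = "Suc _"])

text \<open>\<open>f\<close> moves each generator to the next one and, by assumption, the last one
  back into the span, so the span is invariant.\<close>

lemma cyc_stable:
  assumes "(f ^^ k) x \<in> cyc x k"
  shows "(f ^^ i) x \<in> cyc x k"
proof -
  have "f y \<in> cyc x k" if "y \<in> cyc x k" for y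
    using that unfolding cyc_def
  proof (rule f_span[rotated], clarify)
    fix i assume "i < k"
    then show "f ((f ^^ i) x) \<in> span ((\<lambda>i. (f ^^ i) x) ` {..<k})"
      using assms funpow_in_cyc[of "Suc i" k x] unfolding cyc_def
      by (cases "Suc i = k") auto
  qed
  \<comment> \<open>For \<open>k = 0\<close> this is the assumption itself.\<close>
  moreover have "x \<in> cyc x k"
    using assms funpow_in_cyc[of 0 k x] by (cases k) auto
  ultimately show ?thesis by (induction i) auto
qed

text \<open>Peeling off the last iterate indexes the coefficients by exponents, even if some
  iterates coincide.\<close>

lemma cyc_expand: "y \<in> cyc x k \<Longrightarrow> \<exists>c. y = (\<Sum>i<k. c i *s (f ^^ i) x)"
proof (induction k arbitrary: y)
  case (Suc k)
  then obtain a where "y - a *s (f ^^ k) x \<in> cyc x k"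
    by (auto simp: cyc_def lessThan_Suc span_breakdown_eq)
  then obtain c where "y - a *s (f ^^ k) x = (\<Sum>i<k. c i *s (f ^^ i) x)"
    using Suc.IH by blast
  then have "y = (\<Sum>i<Suc k. (c(k := a)) i *s (f ^^ i) x)"
    by (simp add: algebra_simps)
  then show ?case by blast
qed (simp add: cyc_def)

lemma orbit_independent:
  assumes "\<And>i. i < k \<Longrightarrow> (f ^^ i) x \<notin> cyc x i"
  shows "inj_on (\<lambda>i. (f ^^ i) x) {..<k} \<and> independent ((\<lambda>i. (f ^^ i) x) ` {..<k})"
  using assms
proof (induction k)
  case (Suc k)
  then have IH: "inj_on (\<lambda>i. (f ^^ i) x) {..<k}" "independent ((\<lambda>i. (f ^^ i) x) ` {..<k})"
    by auto
  have "(f ^^ k) x \<notin> span ((\<lambda>i. (f ^^ i) x) ` {..<k})"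
    using Suc.prems[of k] by (simp add: cyc_def)
  with IH show ?case
    using span_base by (auto simp: lessThan_Suc independent_insert)
qed (simp add: independent_empty)

lemma exists_cyc_stable: "\<exists>k\<le>dimension. (f ^^ k) x \<in> cyc x k"
proof (rule ccontr)
  assume "\<not> ?thesis"
  then have *: "inj_on (\<lambda>i. (f ^^ i) x) {..<Suc dimension}"
    "independent ((\<lambda>i. (f ^^ i) x) ` {..<Suc dimension})"
    using orbit_independent[of "Suc dimension" x] by (auto simp: less_Suc_eq_le)
  then have "card ((\<lambda>i. (f ^^ i) x) ` {..<Suc dimension}) = Suc dimension"
    by (simp only: card_image card_lessThan)
  with independent_card_le_dim[OF subset_UNIV *(2)] show False
    by (simp add: dim_UNIV dimension_def)
qed

lemma cyc_deg_stable: "(f ^^ cyc_deg x) x \<in> cyc x (cyc_deg x)"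
  unfolding cyc_deg_def using exists_cyc_stable[of x] LeastI_ex by meson

lemma cyc_deg_le: "cyc_deg x \<le> dimension"
  unfolding cyc_deg_def using exists_cyc_stable[of x] by (meson Least_le le_trans)

lemma cyc_deg_minimal: "k < cyc_deg x \<Longrightarrow> (f ^^ k) x \<notin> cyc x k"
  unfolding cyc_deg_def using not_less_Least by blast


subsection \<open>Horner vectors\<close>

text \<open>\<open>horner c w k\<close> is \<open>f^k w - c 0 f^(k-1) w - ... - c (k-1) w\<close>.
  With the reversed coefficients of a monic polynomial of degree \<open>d\<close>, as used below,
  step \<open>d\<close> gives the value at \<open>w\<close> of that polynomial in
  \<open>f\<close>.\<close>

primrec horner :: "(nat \<Rightarrow> 'k) \<Rightarrow> 'v \<Rightarrow> nat \<Rightarrow> 'v" where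
  "horner c w 0 = w"
| "horner c w (Suc k) = f (horner c w k) - c k *s w"

lemma horner_in_cyc: "horner c w k \<in> cyc w (Suc k)"
proof (induction k)
  case 0
  show ?case using funpow_in_cyc[of 0 1 w] by simp
next
  case (Suc k)
  then have "f (horner c w k) \<in> cyc w (Suc (Suc k))" by (rule f_cyc_Suc)
  moreover have "w \<in> cyc w (Suc (Suc k))" using funpow_in_cyc[of 0 _ w] by simp
  ultimately show ?case by (simp add: subspace_cyc subspace_diff subspace_scale)
qed

text \<open>Read the recursion backwards: \<open>f\<close> sends the \<open>k\<close>-th vector to
  the next one plus a multiple of \<open>w\<close>. Only the last vector needs the vanishing
  condition.\<close>

lemma f_horner_span:
  assumes "k < d" and "k = d - 1 \<Longrightarrow> horner c w d = 0"
  shows "f (horner c w k) \<in> span (horner c w ` {..<d})"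
proof -
  have w: "w \<in> span (horner c w ` {..<d})"
    using assms(1) by (intro span_base image_eqI[of _ _ 0]) auto
  have "horner c w (Suc k) \<in> span (horner c w ` {..<d})"
    using assms by (cases "Suc k = d") (auto simp del: horner.simps intro: span_base span_zero)
  then have "horner c w (Suc k) + c k *s w \<in> span (horner c w ` {..<d})"
    using w by (intro span_add span_scale)
  then show ?thesis by simp
qed

text \<open>With \<open>horner_in_cyc\<close> this shows that the change from iterates to Horner
  vectors is triangular.\<close>

lemma funpow_in_horner_span: "(f ^^ k) w \<in> span (horner c w ` {..k})"
proof (induction k)
  case (Suc k)
  have "f ((f ^^ k) w) \<in> span (horner c w ` {..Suc k})"
  proof (rule f_span[OF _ Suc], clarify)
    fix i assume "i \<le> k"
    \<comment> \<open>One further vector is allowed in the span, so the vanishing condition is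
      vacuous.\<close>
    then have "f (horner c w i) \<in> span (horner c w ` {..<Suc (Suc k)})"
      by (intro f_horner_span) auto
    then show "f (horner c w i) \<in> span (horner c w ` {..Suc k})"
      by (simp add: lessThan_Suc_atMost)
  qed
  then show ?case by simp
qed (auto intro: span_base)

text \<open>Moving \<open>f\<close> across trades a step in \<open>k\<close> for a step in
  \<open>i\<close>. At \<open>i = d - 1\<close> the relation for \<open>f^d v\<close> contributes
  exactly the coefficient that the recursion subtracts. The case \<open>k = d\<close> makes the last
  Horner vector orthogonal to all these iterates.\<close>

lemma sigma_horner:
  assumes v: "(f ^^ d) v = (\<Sum>k<d. c k *s (f ^^ k) v)"
    and w: "\<And>i. i < d \<Longrightarrow> \<sigma> w ((f ^^ i) v) = (if Suc i = d then 1 else 0)"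
  shows "k \<le> d \<Longrightarrow> i < d \<Longrightarrow>
    \<sigma> (horner (\<lambda>k. c (d - 1 - k)) w k) ((f ^^ i) v) = (if Suc (i + k) = d then 1 else 0)"
proof (induction k arbitrary: i)
  case 0
  then show ?case using w by simp
next
  case (Suc k)
  let ?e = "horner (\<lambda>k. c (d - 1 - k)) w"
  have "\<sigma> (?e (Suc k)) ((f ^^ i) v)
      = \<sigma> (?e k) ((f ^^ Suc i) v) - c (d - 1 - k) * \<sigma> w ((f ^^ i) v)"
    by (simp add: sigma_linear_simps sigma_f)
  also have "\<dots> = (if Suc (i + Suc k) = d then 1 else 0)"
  proof (cases "Suc i = d")
    case True
    have "\<sigma> (?e k) ((f ^^ Suc i) v) = (\<Sum>j<d. c j * \<sigma> (?e k) ((f ^^ j) v))"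
      unfolding True v by (simp add: sigma_linear_simps)
    also have "\<dots> = (\<Sum>j<d. if j = d - 1 - k then c j else 0)"
      using Suc by (intro sum.cong) auto
    also have "\<dots> = c (d - 1 - k)" using Suc.prems by simp
    finally show ?thesis using w[OF Suc.prems(2)] True by simp
  next
    case False
    then have "\<sigma> (?e k) ((f ^^ Suc i) v) = (if Suc (Suc i + k) = d then 1 else 0)"
      using Suc.prems by (intro Suc.IH) auto
    then show ?thesis using w[OF Suc.prems(2)] False by simp
  qed
  finally show ?case .
qed

lemma dual_coeff:
  assumes dual: "\<And>i j. i \<in> J \<Longrightarrow> j \<in> J \<Longrightarrow> \<sigma> (e i) (g j) = (if i = j then 1 else 0)"
    and "finite J" "j \<in> J"
  shows "\<sigma> (\<Sum>i\<in>J. a i *s e i) (g j) = a j" "\<sigma> (e j) (\<Sum>i\<in>J. a i *s g i) = a j"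
proof -
  have "\<sigma> (\<Sum>i\<in>J. a i *s e i) (g j) = (\<Sum>i\<in>J. if i = j then a i else 0)"
    unfolding sigma_linear_simps by (rule sum.cong) (auto simp: dual assms)
  then show "\<sigma> (\<Sum>i\<in>J. a i *s e i) (g j) = a j" using assms by simp
  have "\<sigma> (e j) (\<Sum>i\<in>J. a i *s g i) = (\<Sum>i\<in>J. if i = j then a i else 0)"
    unfolding sigma_linear_simps by (rule sum.cong) (auto simp: dual assms)
  then show "\<sigma> (e j) (\<Sum>i\<in>J. a i *s g i) = a j" using assms by simp
qed


subsection \<open>Partial Darboux bases\<close>

text \<open>Each half is invariant separately, which makes \<open>f\<close> block diagonal. The
  empty family \<open>n = 0\<close> starts the construction.\<close>

definition partial_darboux :: "nat \<Rightarrow> (nat \<Rightarrow> 'v) \<Rightarrow> (nat \<Rightarrow> 'v) \<Rightarrow> bool" where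
  "partial_darboux n u w \<longleftrightarrow>
     (\<forall>i\<in>{1..n}. \<forall>j\<in>{1..n}.
        \<sigma> (u i) (u j) = 0 \<and> \<sigma> (w i) (w j) = 0 \<and> \<sigma> (w i) (u j) = (if i = j then 1 else 0)) \<and>
     (\<forall>i\<in>{1..n}. f (u i) \<in> span (u ` {1..n}) \<and> f (w i) \<in> span (w ` {1..n}))"

text \<open>Pairing a vanishing combination with \<open>w j\<close> isolates the coefficient of
  \<open>u j\<close>, and pairing it with \<open>u j\<close> isolates that of
  \<open>w j\<close>.\<close>

lemma partial_darboux_independent:
  assumes "partial_darboux n u w"
  shows "inj_on u {1..n}" "inj_on w {1..n}" "u ` {1..n} \<inter> w ` {1..n} = {}"
    and "independent (u ` {1..n} \<union> w ` {1..n})"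
proof -
  let ?I = "{1..n}"
  have rel: "\<sigma> (u i) (u j) = 0" "\<sigma> (w i) (w j) = 0" "\<sigma> (w i) (u j) = (if i = j then 1 else 0)"
    if "i \<in> ?I" "j \<in> ?I" for i j
    using assms that by (auto simp: partial_darboux_def)
  show inj_u: "inj_on u ?I"
    by (rule inj_onI) (metis rel(3) zero_neq_one)
  show inj_w: "inj_on w ?I"
    by (rule inj_onI) (metis rel(3) zero_neq_one)
  show disj: "u ` ?I \<inter> w ` ?I = {}"
    using rel(2,3) by (force simp: disjoint_iff)
  show "independent (u ` ?I \<union> w ` ?I)"
  proof (rule independent_if_scalars_zero)
    fix g x assume "(\<Sum>x\<in>u ` ?I \<union> w ` ?I. g x *s x) = 0" and x: "x \<in> u ` ?I \<union> w ` ?I"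
    then have eq: "(\<Sum>i\<in>?I. g (u i) *s u i) + (\<Sum>i\<in>?I. g (w i) *s w i) = 0"
      using disj inj_u inj_w by (simp add: sum.union_disjoint sum.reindex)
    have "g (u j) = 0" if j: "j \<in> ?I" for j
    proof -
      have "0 = \<sigma> (w j) ((\<Sum>i\<in>?I. g (u i) *s u i) + (\<Sum>i\<in>?I. g (w i) *s w i))"
        unfolding eq by (simp add: sigma_linear_simps)
      also have "\<dots> = g (u j)"
        using dual_coeff(2)[of ?I w u j "\<lambda>i. g (u i)", OF rel(3)] j
        by (simp add: sigma_linear_simps rel(2))
      finally show ?thesis by simp
    qed
    moreover have "g (w j) = 0" if j: "j \<in> ?I" for j
    proof -
      have "0 = \<sigma> ((\<Sum>i\<in>?I. g (u i) *s u i) + (\<Sum>i\<in>?I. g (w i) *s w i)) (u j)"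
        unfolding eq by (simp add: sigma_linear_simps)
      also have "\<dots> = g (w j)"
        using dual_coeff(1)[of ?I w u j "\<lambda>i. g (w i)", OF rel(3)] j
        by (simp add: sigma_linear_simps rel(1))
      finally show ?thesis by simp
    qed
    ultimately show "g x = 0" using x by auto
  qed simp
qed

lemma partial_darboux_card:
  assumes "partial_darboux n u w"
  shows "card (u ` {1..n} \<union> w ` {1..n}) = 2 * n"
  using partial_darboux_independent[OF assms] by (simp add: card_Un_disjoint card_image)

definition perp :: "nat \<Rightarrow> (nat \<Rightarrow> 'v) \<Rightarrow> (nat \<Rightarrow> 'v) \<Rightarrow> 'v set" where
  "perp n u w = {x. \<forall>i\<in>{1..n}. \<sigma> (u i) x = 0 \<and> \<sigma> (w i) x = 0}"

text \<open>Self-adjointness moves \<open>f\<close> onto the \<open>u i\<close> and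
  \<open>w i\<close>, whose images stay in spans orthogonal to \<open>x\<close>.\<close>

lemma f_perp:
  assumes "partial_darboux n u w" "x \<in> perp n u w"
  shows "f x \<in> perp n u w"
proof -
  have "\<sigma> y x = 0" if "y \<in> span (u ` {1..n}) \<or> y \<in> span (w ` {1..n})" for y
    using that sigma_span_eq_0[of "u ` {1..n}" "{x}" y x] sigma_span_eq_0[of "w ` {1..n}" "{x}" y x]
      assms(2) by (auto simp: perp_def span_base)
  then show ?thesis
    using assms(1) by (auto simp: perp_def partial_darboux_def simp flip: sigma_f)
qed

lemma funpow_perp:
  assumes "partial_darboux n u w" "x \<in> perp n u w"
  shows "(f ^^ k) x \<in> perp n u w"
  using assms by (induction k) (auto intro: f_perp)

lemma cyc_perp:
  assumes "partial_darboux n u w" "x \<in> perp n u w" "y \<in> cyc x k"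
  shows "y \<in> perp n u w"
proof -
  have "\<sigma> a y = 0" if "a \<in> u ` {1..n} \<union> w ` {1..n}" for a
    using assms(3) unfolding cyc_def
  proof (rule sigma_span_eq_0[rotated 2])
    show "a \<in> span (u ` {1..n} \<union> w ` {1..n})" using that by (rule span_base)
  next
    fix a b assume "a \<in> u ` {1..n} \<union> w ` {1..n}" "b \<in> (\<lambda>i. (f ^^ i) x) ` {..<k}"
    then show "\<sigma> a b = 0" using funpow_perp[OF assms(1,2)] by (auto simp: perp_def)
  qed
  then show ?thesis by (auto simp: perp_def)
qed

text \<open>Orthogonal projection onto the complement. The argument orders
  \<open>\<sigma> (w i) x\<close> and \<open>\<sigma> x (u i)\<close> avoid signs, since
  \<open>\<sigma> (w i) (u i) = 1\<close>.\<close>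

lemma perp_decompose:
  assumes "partial_darboux n u w"
  shows "x - (\<Sum>i\<in>{1..n}. \<sigma> (w i) x *s u i) - (\<Sum>i\<in>{1..n}. \<sigma> x (u i) *s w i) \<in> perp n u w"
proof -
  let ?I = "{1..n}"
  let ?a = "\<Sum>i\<in>?I. \<sigma> (w i) x *s u i" and ?b = "\<Sum>i\<in>?I. \<sigma> x (u i) *s w i"
  have rel: "\<sigma> (u i) (u j) = 0" "\<sigma> (w i) (w j) = 0" "\<sigma> (w i) (u j) = (if i = j then 1 else 0)"
    if "i \<in> ?I" "j \<in> ?I" for i j
    using assms that by (auto simp: partial_darboux_def)
  have "\<sigma> (w j) (x - ?a - ?b) = 0" if j: "j \<in> ?I" for j
  proof -
    have "\<sigma> (w j) ?a = \<sigma> (w j) x"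
      using j by (intro dual_coeff(2)[of ?I w u j "\<lambda>i. \<sigma> (w i) x", OF rel(3)]) auto
    moreover have "\<sigma> (w j) ?b = 0" using j by (simp add: sigma_linear_simps rel(2))
    ultimately show ?thesis by (simp only: sigma_linear_simps(7)) simp
  qed
  moreover have "\<sigma> (u j) (x - ?a - ?b) = 0" if j: "j \<in> ?I" for j
  proof -
    have "\<sigma> ?b (u j) = \<sigma> x (u j)"
      using j by (intro dual_coeff(1)[of ?I w u j "\<lambda>i. \<sigma> x (u i)", OF rel(3)]) auto
    moreover have "\<sigma> ?a (u j) = 0" using j by (simp add: sigma_linear_simps rel(1))
    ultimately have "\<sigma> (x - ?a - ?b) (u j) = 0" by (simp only: sigma_linear_simps(2)) simp
    then show ?thesis using sigma_swap[of "u j"] by simp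
  qed
  ultimately show ?thesis by (simp add: perp_def)
qed

section \<open>Extension by a cyclic subspace and its dual\<close>

text \<open>Project a dual vector of the whole space to the complement: the subtracted terms are
  orthogonal to \<open>I\<close>, so the prescribed values survive.\<close>

lemma exists_dual_in_perp:
  assumes pd: "partial_darboux n u w" and "independent I" "I \<subseteq> perp n u w"
  shows "\<exists>y\<in>perp n u w. \<forall>b\<in>I. \<sigma> y b = g b"
proof -
  obtain x where x: "\<forall>b\<in>I. \<sigma> x b = g b" using exists_dual_vector[OF assms(2)] by blast
  define y where "y = x - (\<Sum>i\<in>{1..n}. \<sigma> (w i) x *s u i) - (\<Sum>i\<in>{1..n}. \<sigma> x (u i) *s w i)"
  have "\<sigma> y b = g b" if b: "b \<in> I" for b
  proof -
    have "\<forall>i\<in>{1..n}. \<sigma> (u i) b = 0 \<and> \<sigma> (w i) b = 0" using b assms(3) by (auto simp: perp_def)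
    then show ?thesis using x b by (simp add: y_def sigma_linear_simps)
  qed
  with perp_decompose[OF pd, of x] show ?thesis unfolding y_def by blast
qed

text \<open>
  Taking \<^term>\<open>v\<close> of maximal cyclic degree makes the annihilators of \<^term>\<open>v\<close> and of its dual vector
  agree, so that the last Horner vector vanishes; no vector realising the minimal polynomial of
  \<^term>\<open>f\<close> is needed.
\<close>
lemma exists_cyclic_pair:
  assumes pd: "partial_darboux n u w" and ne: "perp n u w \<noteq> {0}"
  obtains d v y c where "d > 0" "v \<in> perp n u w" "y \<in> perp n u w"
    "(f ^^ d) v \<in> cyc v d" "horner c y d = 0"
    "\<And>i k. i < d \<Longrightarrow> k < d \<Longrightarrow> \<sigma> (horner c y k) ((f ^^ i) v) = (if Suc (i + k) = d then 1 else 0)"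
proof -
  let ?T = "perp n u w"
  have 0: "0 \<in> ?T" by (simp add: perp_def sigma_linear_simps)
  have "\<exists>v. v \<in> ?T \<and> (\<forall>x. x \<in> ?T \<longrightarrow> cyc_deg x \<le> cyc_deg v)"
    using 0 cyc_deg_le by (intro ex_has_greatest_nat[where b = "Suc dimension"]) (auto simp: less_Suc_eq_le)
  then obtain v where v: "v \<in> ?T" and max: "\<And>x. x \<in> ?T \<Longrightarrow> cyc_deg x \<le> cyc_deg v" by blast
  define d where "d = cyc_deg v"
  have "d > 0"
  proof -
    obtain x where x: "x \<in> ?T" "x \<noteq> 0" using ne 0 by blast
    have "cyc_deg x \<noteq> 0"
      using cyc_deg_stable[of x] x(2) by (intro notI) (simp add: cyc_def)
    with max[OF x(1)] show ?thesis by (simp add: d_def)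
  qed
  have dv: "(f ^^ d) v \<in> cyc v d" unfolding d_def by (rule cyc_deg_stable)
  then obtain a where a: "(f ^^ d) v = (\<Sum>k<d. a k *s (f ^^ k) v)" using cyc_expand by blast
  have ind: "inj_on (\<lambda>i. (f ^^ i) v) {..<d}" "independent ((\<lambda>i. (f ^^ i) v) ` {..<d})"
    using orbit_independent[of d v] cyc_deg_minimal by (auto simp: d_def)
  have sub: "(\<lambda>i. (f ^^ i) v) ` {..<d} \<subseteq> ?T" using funpow_perp[OF pd v] by auto
  obtain y where y: "y \<in> ?T"
    and dual: "\<forall>b\<in>(\<lambda>i. (f ^^ i) v) ` {..<d}. \<sigma> y b = (if b = (f ^^ (d - 1)) v then 1 else 0)"
    using exists_dual_in_perp[OF pd ind(2) sub, of "\<lambda>b. if b = (f ^^ (d - 1)) v then 1 else 0"]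
    by blast
  have yv: "\<sigma> y ((f ^^ i) v) = (if Suc i = d then 1 else 0)" if "i < d" for i
    using dual that inj_onD[OF ind(1), of i "d - 1"] by (auto split: if_splits)
  let ?e = "horner (\<lambda>k. a (d - 1 - k)) y"
  have dual_e: "\<sigma> (?e k) ((f ^^ i) v) = (if Suc (i + k) = d then 1 else 0)" if "k \<le> d" "i < d" for i k
    using sigma_horner[OF a yv that] .
  \<comment> \<open>By maximality \<open>cyc y d\<close> contains all iterates of \<open>y\<close>,
    so \<open>?e d\<close> is a combination of the earlier Horner vectors. Pairing with
    \<open>f^(d-1-k) v\<close> reads off the \<open>k\<close>-th coefficient, yet
    \<open>?e d\<close> is orthogonal to that iterate.\<close>
  have "?e d = 0"
  proof -
    have "(f ^^ i) y \<in> cyc y d" for i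
      using cyc_stable[OF cyc_deg_stable, of i y] max[OF y] cyc_mono unfolding d_def by blast
    then have "cyc y (Suc d) \<subseteq> cyc y d"
      unfolding cyc_def[of y "Suc d"] by (intro span_minimal subspace_cyc) auto
    then have "?e d \<in> cyc y d" using horner_in_cyc by blast
    moreover have "cyc y d \<subseteq> span (?e ` {..<d})"
      unfolding cyc_def
    proof (intro span_minimal subspace_span image_subsetI)
      fix i assume "i \<in> {..<d}"
      then have "span (?e ` {..i}) \<subseteq> span (?e ` {..<d})" by (intro span_mono) auto
      then show "(f ^^ i) y \<in> span (?e ` {..<d})" using funpow_in_horner_span by blast
    qed
    ultimately have "?e d \<in> span (?e ` {..<d})" by blast
    moreover have inj: "inj_on ?e {..<d}"
    proof (rule inj_onI)
      fix k l assume kl: "k \<in> {..<d}" "l \<in> {..<d}" "?e k = ?e l"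
      then show "k = l"
        using dual_e[of k "d - 1 - k"] dual_e[of l "d - 1 - k"] by (auto split: if_splits)
    qed
    ultimately obtain q where "?e d = (\<Sum>x\<in>?e ` {..<d}. q x *s x)"
      using span_finite[of "?e ` {..<d}"] by auto
    then have q: "?e d = (\<Sum>k<d. q (?e k) *s ?e k)" by (simp only: sum.reindex[OF inj] o_def)
    have "q (?e k) = 0" if k: "k < d" for k
    proof -
      have "\<sigma> (?e d) ((f ^^ (d - 1 - k)) v) = q (?e k)"
        unfolding q
        by (rule dual_coeff(1)[where e = ?e and g = "\<lambda>k. (f ^^ (d - 1 - k)) v"
              and a = "\<lambda>k. q (?e k)"]) (use k dual_e in auto)
      moreover have "\<sigma> (?e d) ((f ^^ (d - 1 - k)) v) = 0" using dual_e[of d] k by simp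
      ultimately show ?thesis by simp
    qed
    then show ?thesis unfolding q by simp
  qed
  with \<open>d > 0\<close> v y dv dual_e show ?thesis using that[of d v y "\<lambda>k. a (d - 1 - k)"] by auto
qed

lemma partial_darboux_extend:
  assumes pd: "partial_darboux n u w" and ne: "perp n u w \<noteq> {0}"
  shows "\<exists>m>n. \<exists>u' w'. partial_darboux m u' w'"
proof -
  obtain d v y c where d: "d > 0" and v: "v \<in> perp n u w" and y: "y \<in> perp n u w"
    and dv: "(f ^^ d) v \<in> cyc v d" and e0: "horner c y d = 0"
    and dual: "\<And>i k. i < d \<Longrightarrow> k < d \<Longrightarrow>
      \<sigma> (horner c y k) ((f ^^ i) v) = (if Suc (i + k) = d then 1 else 0)"
    using exists_cyclic_pair[OF pd ne] by metis
  let ?e = "horner c y"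
  define u' where "u' i = (if i \<le> n then u i else (f ^^ (i - n - 1)) v)" for i
  \<comment> \<open>The Horner vectors enter in reverse: index \<open>n + 1 + t\<close> carries
    \<open>f^t v\<close> and \<open>?e (d - 1 - t)\<close>, which pair to 1.\<close>
  define w' where "w' i = (if i \<le> n then w i else ?e (n + d - i))" for i
  let ?I = "{1..n + d}"
  have pd': "\<sigma> (u i) (u j) = 0" "\<sigma> (w i) (w j) = 0" "\<sigma> (w i) (u j) = (if i = j then 1 else 0)"
    if "1 \<le> i" "i \<le> n" "1 \<le> j" "j \<le> n" for i j
    using pd that by (auto simp: partial_darboux_def)
  have perp_v: "\<sigma> (u i) ((f ^^ k) v) = 0" "\<sigma> (w i) ((f ^^ k) v) = 0"
    "\<sigma> ((f ^^ k) v) (u i) = 0" if "1 \<le> i" "i \<le> n" for i k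
    using funpow_perp[OF pd v, of k] that sigma_swap[of "(f ^^ k) v" "u i"]
    by (auto simp: perp_def)
  have perp_e: "\<sigma> (u i) (?e k) = 0" "\<sigma> (w i) (?e k) = 0" "\<sigma> (?e k) (u i) = 0" "\<sigma> (?e k) (w i) = 0"
    if "1 \<le> i" "i \<le> n" for i k
    using cyc_perp[OF pd y horner_in_cyc[of c y k]] that
      sigma_swap[of "?e k" "u i"] sigma_swap[of "?e k" "w i"]
    by (auto simp: perp_def)
  \<comment> \<open>Horner vectors lie in a cyclic subspace of \<open>y\<close>, which is
    isotropic.\<close>
  have ee: "\<sigma> (?e i) (?e j) = 0" for i j
    by (rule sigma_span_eq_0[OF _ horner_in_cyc[of c y i, unfolded cyc_def]
          horner_in_cyc[of c y j, unfolded cyc_def]]) (auto simp: sigma_orbit)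
  have u_sub: "u ` {1..n} \<subseteq> u' ` ?I" by (auto simp: u'_def image_iff intro!: bexI)
  have w_sub: "w ` {1..n} \<subseteq> w' ` ?I" by (auto simp: w'_def image_iff intro!: bexI)
  have v_sub: "(\<lambda>i. (f ^^ i) v) ` {..<d} \<subseteq> u' ` ?I"
  proof (rule image_subsetI)
    fix i assume "i \<in> {..<d}"
    then show "(f ^^ i) v \<in> u' ` ?I" by (intro image_eqI[of _ _ "n + 1 + i"]) (auto simp: u'_def)
  qed
  have e_sub: "?e ` {..<d} \<subseteq> w' ` ?I"
  proof (rule image_subsetI)
    fix i assume "i \<in> {..<d}"
    then show "?e i \<in> w' ` ?I" by (intro image_eqI[of _ _ "n + d - i"]) (auto simp: w'_def)
  qed
  have rel: "\<sigma> (u' i) (u' j) = 0 \<and> \<sigma> (w' i) (w' j) = 0 \<and> \<sigma> (w' i) (u' j) = (if i = j then 1 else 0)"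
    if "i \<in> ?I" "j \<in> ?I" for i j
    using that dual[of "j - n - 1" "n + d - i"]
    by (auto simp: u'_def w'_def pd' perp_v perp_e ee sigma_orbit)
  have fu: "f (u' i) \<in> span (u' ` ?I)" if i: "i \<in> ?I" for i
  proof (cases "i \<le> n")
    case True
    then have "f (u' i) \<in> span (u ` {1..n})" using pd i by (auto simp: partial_darboux_def u'_def)
    then show ?thesis using span_mono[OF u_sub] by blast
  next
    case False
    have "f (u' i) = (f ^^ Suc (i - n - 1)) v" using False by (simp add: u'_def)
    also have "\<dots> \<in> cyc v d" by (rule cyc_stable[OF dv])
    finally show ?thesis using span_mono[OF v_sub] unfolding cyc_def by blast
  qed
  have fw: "f (w' i) \<in> span (w' ` ?I)" if i: "i \<in> ?I" for i
  proof (cases "i \<le> n")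
    case True
    then have "f (w' i) \<in> span (w ` {1..n})" using pd i by (auto simp: partial_darboux_def w'_def)
    then show ?thesis using span_mono[OF w_sub] by blast
  next
    case False
    \<comment> \<open>For \<open>i = n + 1\<close> the next Horner vector is \<open>?e d\<close>,
      and \<open>e0\<close> closes the chain.\<close>
    have "f (?e (n + d - i)) \<in> span (?e ` {..<d})"
      using False i e0 by (intro f_horner_span) auto
    then show ?thesis using False span_mono[OF e_sub] by (auto simp: w'_def)
  qed
  have "partial_darboux (n + d) u' w'" using rel fu fw unfolding partial_darboux_def by blast
  then show ?thesis using d by (intro exI[of _ "n + d"]) auto
qed

text \<open>Independence bounds the size of a partial family, so a largest one exists. It cannot be
  extended, hence its complement vanishes, it spans, and counting dimensions gives its size.\<close>

lemma exists_invariant_darboux: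
  assumes dim: "dim (UNIV :: 'v set) = 2 * n"
  obtains u w where "partial_darboux n u w" "perp n u w = {0}"
    "span (u ` {1..n} \<union> w ` {1..n}) = UNIV"
proof -
  have bound: "m < Suc n" if "partial_darboux m u w" for m u w
    using independent_card_le_dim[OF subset_UNIV partial_darboux_independent(4)[OF that]]
      partial_darboux_card[OF that] dim by simp
  have "\<exists>m. (\<exists>u w. partial_darboux m u w) \<and> (\<forall>k. (\<exists>u w. partial_darboux k u w) \<longrightarrow> k \<le> m)"
  proof (rule ex_has_greatest_nat[where b = "Suc n" and k = 0])
    show "\<exists>u w. partial_darboux 0 u w" by (simp add: partial_darboux_def)
  qed (use bound in blast)
  then obtain m u w where pd: "partial_darboux m u w"
    and max: "\<And>k u w. partial_darboux k u w \<Longrightarrow> k \<le> m" by blast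
  have perp: "perp m u w = {0}" using partial_darboux_extend[OF pd] max by (meson not_less)
  have "x \<in> span (u ` {1..m} \<union> w ` {1..m})" for x
  proof -
    have "x = (\<Sum>i\<in>{1..m}. \<sigma> (w i) x *s u i) + (\<Sum>i\<in>{1..m}. \<sigma> x (u i) *s w i)"
      using perp_decompose[OF pd, of x] perp by (simp add: algebra_simps)
    also have "\<dots> \<in> span (u ` {1..m} \<union> w ` {1..m})"
      by (intro span_add span_sum span_scale span_base) auto
    finally show ?thesis .
  qed
  then have sp: "span (u ` {1..m} \<union> w ` {1..m}) = UNIV" by blast
  then have "dim (UNIV :: 'v set) = 2 * m"
    using dim_span_eq_card_independent[OF partial_darboux_independent(4)[OF pd]]
      partial_darboux_card[OF pd] by simp
  with dim have "m = n" by simp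
  with pd perp sp that show ?thesis by blast
qed

end

section \<open>The isomorphism from \<open>U\<close> times its dual\<close>

theorem corollary11:
  fixes smul :: "'k::field \<Rightarrow> 'v::ab_group_add \<Rightarrow> 'v"
    and B :: "'v set" and \<sigma> :: "'v \<Rightarrow> 'v \<Rightarrow> 'k" and f :: "'v \<Rightarrow> 'v" and n :: nat
  assumes "perfect_field TYPE('k)"
    and "CHAR('k) \<noteq> 2"
    and "finite_dimensional_vector_space smul B"
    and "vector_space.dim smul (UNIV :: 'v set) = 2 * n"
    and "n > 0"
    and "symplectic_form smul \<sigma>"
    and "Vector_Spaces.linear smul smul f"
    and "self_adjoint \<sigma> f"
  shows "\<exists>u w l.
    darboux_basis smul \<sigma> n u w \<and>
    (let U = module.span smul (u ` {1..n}) in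
      linear_on smul smul U U l \<and>
      (\<exists>lam \<Phi>.
        dual_basis smul U n u lam \<and>
        linear_on (module_prod.scale smul fun_scale) smul (U \<times> dual_space smul U) UNIV \<Phi> \<and>
        bij_betw \<Phi> (U \<times> dual_space smul U) UNIV \<and>
        (\<forall>i\<in>{1..n}. \<Phi> (u i, 0) = u i \<and> \<Phi> (0, lam i) = w i) \<and>
        (\<forall>p \<in> U \<times> dual_space smul U. \<Phi> (map_prod l (dual_map U l) p) = f (\<Phi> p))))"
proof -
  interpret self_adjoint_symplectic smul B \<sigma> f
    using assms(2,3,6,7,8)
    by (simp add: self_adjoint_symplectic_def self_adjoint_symplectic_axioms_def)
  obtain u w where pd: "partial_darboux n u w" and perp: "perp n u w = {0}"
    and span: "span (u ` {1..n} \<union> w ` {1..n}) = UNIV"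
    using exists_invariant_darboux[OF assms(4)] .
  let ?I = "{1..n}"
  have uu: "\<sigma> (u i) (u j) = 0" and ww: "\<sigma> (w i) (w j) = 0"
    and wu: "\<sigma> (w i) (u j) = (if i = j then 1 else 0)" if "i \<in> ?I" "j \<in> ?I" for i j
    using pd that by (auto simp: partial_darboux_def)
  define U where "U = span (u ` ?I)"
  define D where "D = dual_space smul U"
  define lam where "lam i = (\<lambda>x. if x \<in> U then \<sigma> (w i) x else 0)" for i
  \<comment> \<open>The coordinate formula forced by the prescribed values. Its inverse sends
    \<open>y\<close> to the pair of \<open>\<Sum>i. \<sigma> (w i) y u i\<close> and the restriction
    of \<open>\<sigma> y\<close> to \<open>U\<close>.\<close>
  define \<Phi> where "\<Phi> p = fst p + (\<Sum>i\<in>?I. smul (snd p (u i)) (w i))" for p :: "'v \<times> ('v \<Rightarrow> 'k)"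
  have U: "subspace U" by (simp add: U_def)
  have uU: "u i \<in> U" if "i \<in> ?I" for i using that by (auto simp: U_def intro: span_base)
  have fU: "f x \<in> U" if "x \<in> U" for x
    using that unfolding U_def by (rule f_span[rotated]) (use pd in \<open>auto simp: partial_darboux_def\<close>)
  have UU: "\<sigma> x y = 0" if "x \<in> U" "y \<in> U" for x y
    using that unfolding U_def by (rule sigma_span_eq_0[rotated]) (auto simp: uu)
  \<comment> \<open>The equality test for all later identities: the difference is orthogonal to
    every \<open>u i\<close> and \<open>w i\<close>, so it lies in the zero complement.\<close>
  have eqI: "x = y" if "\<And>j. j \<in> ?I \<Longrightarrow> \<sigma> (w j) x = \<sigma> (w j) y" "\<And>z. z \<in> U \<Longrightarrow> \<sigma> x z = \<sigma> y z" for x y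
  proof -
    have "\<sigma> (u i) x = \<sigma> (u i) y" if "i \<in> ?I" for i
      using \<open>\<And>z. z \<in> U \<Longrightarrow> \<sigma> x z = \<sigma> y z\<close>[OF uU[OF that]]
        sigma_swap[of "u i" x] sigma_swap[of "u i" y] by simp
    then have "x - y \<in> perp n u w" using that by (auto simp: perp_def sigma_linear_simps)
    then show ?thesis using perp by simp
  qed
  have D_0: "\<phi> 0 = 0" if "\<phi> \<in> D" for \<phi>
  proof -
    have "\<phi> (smul 0 0) = 0 * \<phi> 0"
      using that subspace_0[OF U] unfolding D_def dual_space_def linear_on_def by blast
    then show ?thesis by simp
  qed
  have D_ext: "\<phi> x = \<psi> x" if "\<phi> \<in> D" "\<psi> \<in> D" "x \<in> U" "\<And>i. i \<in> ?I \<Longrightarrow> \<phi> (u i) = \<psi> (u i)" for \<phi> \<psi> x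
  proof -
    have "x \<in> U \<and> \<phi> x = \<psi> x"
      using that(3) unfolding U_def
    proof (induction rule: span_induct_alt)
      case base
      show ?case using D_0[OF that(1)] D_0[OF that(2)] by (simp add: span_zero)
    next
      case (step c x y)
      then have "x \<in> U" "smul c x \<in> U" "y \<in> U" "\<phi> x = \<psi> x"
        using that(4) by (auto simp: U_def span_base span_scale)
      then show ?case
        using step that(1,2) by (auto simp: D_def dual_space_def linear_on_def U_def span_add)
    qed
    then show ?thesis by simp
  qed
  have sigma_D: "(\<lambda>x. if x \<in> U then \<sigma> y x else 0) \<in> D" for y
    using U by (auto simp: D_def dual_space_def linear_on_def sigma_linear_simps
        subspace_add subspace_scale)
  have w_\<Phi>: "\<sigma> (w j) (\<Phi> (x, \<phi>)) = \<sigma> (w j) x" if "j \<in> ?I" for j x \<phi>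
    using that by (simp add: \<Phi>_def sigma_linear_simps ww)
  \<comment> \<open>\<open>U\<close> is isotropic, so \<open>x\<close> contributes nothing and
    pairing with \<open>U\<close> recovers the functional.\<close>
  have \<Phi>_U: "\<sigma> (\<Phi> (x, \<phi>)) z = \<phi> z" if "x \<in> U" "\<phi> \<in> D" "z \<in> U" for x \<phi> z
  proof -
    have "\<sigma> (\<Phi> (x, \<phi>)) (u j) = \<phi> (u j)" if j: "j \<in> ?I" for j
      using dual_coeff(1)[of ?I w u j "\<lambda>i. \<phi> (u i)", OF wu] j UU[OF \<open>x \<in> U\<close> uU[OF j]]
      by (simp add: \<Phi>_def sigma_linear_simps(1) wu)
    then show ?thesis
      using D_ext[OF sigma_D[of "\<Phi> (x, \<phi>)"] that(2,3)] uU that(3) by simp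
  qed
  have darboux: "darboux_basis smul \<sigma> n u w"
    using partial_darboux_independent[OF pd] span uu ww wu by (simp add: darboux_basis_def)
  have lin_f: "linear_on smul smul U U f"
    using fU by (auto simp: linear_on_def f_linear_simps)
  have dual: "dual_basis smul U n u lam"
    using sigma_D uU wu by (auto simp: dual_basis_def lam_def D_def)
  have lin_\<Phi>: "linear_on (module_prod.scale smul fun_scale) smul (U \<times> D) UNIV \<Phi>"
    by (auto simp: linear_on_def prod_scale_fun_scale[OF vector_space_axioms] \<Phi>_def
        fun_scale_def scale_left_distrib scale_right_distrib sum.distrib scale_sum_right)
  have "inj_on \<Phi> (U \<times> D)"
  proof (rule inj_onI, clarify)
    fix x \<phi> y \<psi> assume xy: "x \<in> U" "\<phi> \<in> D" "y \<in> U" "\<psi> \<in> D" and eq: "\<Phi> (x, \<phi>) = \<Phi> (y, \<psi>)"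
    have "x = y" by (rule eqI) (use w_\<Phi> eq UU xy in metis)+
    moreover have "\<phi> z = \<psi> z" for z
      using \<Phi>_U[OF xy(1,2)] \<Phi>_U[OF xy(3,4)] eq xy(2,4)
      by (cases "z \<in> U") (auto simp: D_def dual_space_def)
    ultimately show "x = y \<and> \<phi> = \<psi>" by auto
  qed
  moreover have "y \<in> \<Phi> ` (U \<times> D)" for y
  proof
    let ?x = "\<Sum>i\<in>?I. smul (\<sigma> (w i) y) (u i)" and ?\<phi> = "\<lambda>x. if x \<in> U then \<sigma> y x else 0"
    have x: "?x \<in> U" using uU U by (auto intro!: subspace_sum subspace_scale)
    with sigma_D show "(?x, ?\<phi>) \<in> U \<times> D" by simp
    show "y = \<Phi> (?x, ?\<phi>)"
    proof (rule eqI)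
      fix j assume j: "j \<in> ?I"
      have "\<sigma> (w j) ?x = \<sigma> (w j) y"
        using j by (intro dual_coeff(2)[of ?I w u j "\<lambda>i. \<sigma> (w i) y", OF wu]) auto
      then show "\<sigma> (w j) y = \<sigma> (w j) (\<Phi> (?x, ?\<phi>))"
        using j by (simp add: w_\<Phi>)
    next
      fix z assume "z \<in> U"
      then show "\<sigma> y z = \<sigma> (\<Phi> (?x, ?\<phi>)) z" by (simp only: \<Phi>_U[OF x sigma_D] if_True)
    qed
  qed
  ultimately have bij: "bij_betw \<Phi> (U \<times> D) UNIV" by (auto simp: bij_betw_def)
  have basis: "\<Phi> (u i, 0) = u i \<and> \<Phi> (0, lam i) = w i" if i: "i \<in> ?I" for i
  proof -
    have "(\<Sum>j\<in>?I. smul (lam i (u j)) (w j)) = (\<Sum>j\<in>?I. if i = j then w j else 0)"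
      by (rule sum.cong) (auto simp: lam_def uU wu[OF i])
    then show ?thesis using i by (simp add: \<Phi>_def)
  qed
  \<comment> \<open>The witness for \<open>l\<close> is \<open>f\<close> itself. Against
    \<open>w j\<close>, invariance and isotropy of the span of the \<open>w i\<close> kill the
    functional part; against \<open>z\<close> in \<open>U\<close>, both sides give
    \<open>\<phi> (f z)\<close>.\<close>
  have "\<Phi> (f x, dual_map U f \<phi>) = f (\<Phi> (x, \<phi>))" if x: "x \<in> U" and \<phi>: "\<phi> \<in> D" for x \<phi>
  proof (rule eqI)
    fix j assume j: "j \<in> ?I"
    have "f (w j) \<in> span (w ` ?I)" using pd j by (auto simp: partial_darboux_def)
    moreover have "(\<Sum>i\<in>?I. smul (\<phi> (u i)) (w i)) \<in> span (w ` ?I)"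
      by (intro span_sum span_scale span_base) auto
    ultimately have "\<sigma> (f (w j)) (\<Sum>i\<in>?I. smul (\<phi> (u i)) (w i)) = 0"
      by (rule sigma_span_eq_0[rotated]) (auto simp: ww)
    then have "\<sigma> (w j) (f (\<Phi> (x, \<phi>))) = \<sigma> (f (w j)) x"
      by (simp add: \<Phi>_def sigma_linear_simps(6) flip: sigma_f)
    then show "\<sigma> (w j) (\<Phi> (f x, dual_map U f \<phi>)) = \<sigma> (w j) (f (\<Phi> (x, \<phi>)))"
      using j by (simp add: w_\<Phi> sigma_f)
  next
    fix z assume z: "z \<in> U"
    have "dual_map U f \<phi> \<in> D"
      using dual_map_in_dual_space[OF vector_space_axioms U lin_f] \<phi> by (simp add: D_def)
    then have "\<sigma> (\<Phi> (f x, dual_map U f \<phi>)) z = \<phi> (f z)"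
      using \<Phi>_U fU x z by (simp add: dual_map_def)
    then show "\<sigma> (\<Phi> (f x, dual_map U f \<phi>)) z = \<sigma> (f (\<Phi> (x, \<phi>))) z"
      using \<Phi>_U[OF x \<phi> fU[OF z]] by (simp add: sigma_f)
  qed
  then have "\<forall>p \<in> U \<times> D. \<Phi> (map_prod f (dual_map U f) p) = f (\<Phi> p)" by auto
  with darboux lin_f dual lin_\<Phi> bij basis show ?thesis
    unfolding Let_def D_def U_def
    by (intro exI[of _ u] exI[of _ w] exI[of _ f] exI[of _ lam] exI[of _ \<Phi>] conjI ballI) blast+
qed

end
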